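(* Let $\mathcal{A}$ be a Boolean tensor of size $I_1\times\cdots\times I_M\times J_1\times\cdots\times J_N$. Then the following statements are equivalent: (a) A $\{1,3\}$-inverse $\mathcal{A}^{(1,3)}$ of $\mathcal{A}$ exists. (b) A generalized inverse $\mathcal{A}^{(1)}$ of $\mathcal{A}$ exists and $\mathfrak{R}(\mathcal{A}^T)=\mathfrak{R}(\mathcal{A}^T*_M\mathcal{A})$. (c) There exists a Boolean tensor $\mathcal{X}$ of size $J_1\times\cdots\times J_N\times I_1\times\cdots\times I_M$ such that $\mathcal{A}^T=\mathcal{A}^T*_M\mathcal{A}*_N\mathcal{X}$.
   Context: A Boolean tensor is an array with entries in $\{0,1\}$; entries are added and multiplied by the rules of the binary Boolean algebra ($1+1=1$, otherwise as usual). For $\mathcal{A}$ of size $I_1\times\cdots\times I_M\times J_1\times\cdots\times J_N$ and $\mathcal{B}$ of size $J_1\times\cdots\times J_N\times K_1\times\cdots\times K_L$, the Einstein product $\mathcal{A}*_N\mathcal{B}$ has entries $\sum_{j_1,\dots,j_N}a_{i_1\ldots i_Mj_1\ldots j_N}b_{j_1\ldots j_Nk_1\ldots k_L}$ (Boolean sum; the $k$-indices may be absent); the subscript of $*$ is the number of contracted indices. The transpose is $(\mathcal{A}^T)_{j_1\ldots j_Ni_1\ldots i_M}=a_{i_1\ldots i_Mj_1\ldots j_N}$. The range is $\mathfrak{R}(\mathcal{A})=\{\mathcal{A}*_N\mathcal{X}:\mathcal{X}\text{ a Boolean tensor of size }J_1\times\cdots\times J_N\}$. A generalized inverse $\mathcal{A}^{(1)}$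 of $\mathcal{A}$ is a Boolean tensor $\mathcal{X}$ of size $J_1\times\cdots\times J_N\times I_1\times\cdots\times I_M$ with $\mathcal{A}*_N\mathcal{X}*_M\mathcal{A}=\mathcal{A}$; a $\{1,3\}$-inverse $\mathcal{A}^{(1,3)}$ is a generalized inverse which in addition satisfies $(\mathcal{A}*_N\mathcal{X})^T=\mathcal{A}*_N\mathcal{X}$. *)

theory Defs
  imports Main
begin

text \<open>The binary Boolean algebra: \<open>0 = False\<close>, \<open>1 = True\<close> and \<open>1 + 1 = 1\<close>.  As a commutative
  semiring it gives access to the library's finite sums, which are then Boolean sums.\<close>

instantiation bool :: comm_semiring_1
begin
definition zero_bool_def: "(0::bool) = False"
definition one_bool_def: "(1::bool) = True"
definition plus_bool_def: "(x::bool) + y = (x \<or> y)"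
definition times_bool_def: "(x::bool) * y = (x \<and> y)"
instance
  by standard (auto simp: zero_bool_def one_bool_def plus_bool_def times_bool_def)
end

definition indices :: "nat list \<Rightarrow> nat list set" where
  "indices ds = listset (map (\<lambda>d. {1..d}) ds)"

text \<open>A Boolean tensor is a list of mode sizes together with its array of entries.  The array is
  \<open>undefined\<close> off the index set, so that equality of tensors is equality of sizes and of entries.\<close>

typedef btensor =
  "{(ds, f). \<forall>p. p \<notin> indices ds \<longrightarrow> f p = undefined} :: (nat list \<times> (nat list \<Rightarrow> bool)) set"
  by (rule exI[of _ "([], \<lambda>_. undefined)"]) simp

definition dims :: "btensor \<Rightarrow> nat list" where
  "dims A = fst (Rep_btensor A)"

definition entry :: "btensor \<Rightarrow> nat list \<Rightarrow> bool" where
  "entry A = snd (Rep_btensor A)"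

definition mk_btensor :: "nat list \<Rightarrow> (nat list \<Rightarrow> bool) \<Rightarrow> btensor" where
  "mk_btensor ds f = Abs_btensor (ds, \<lambda>p. if p \<in> indices ds then f p else undefined)"

text \<open>In \<open>A *\<^bsub>n\<^esub> B\<close> the last \<open>n\<close> modes of \<open>A\<close> are contracted with the first \<open>n\<close> modes of \<open>B\<close>; it is
  meaningful only if their sizes agree.  A multi-index of the product splits into the
  remaining \<open>r\<close> indices of \<open>A\<close> followed by those of \<open>B\<close>.\<close>

definition einstein_prod :: "btensor \<Rightarrow> nat \<Rightarrow> btensor \<Rightarrow> btensor"
    ("(_ *\<^bsub>_\<^esub> _)" [70, 0, 71] 70) where
  "A *\<^bsub>n\<^esub> B =
     (let r = length (dims A) - n in
      mk_btensor (take r (dims A) @ drop n (dims B))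
        (\<lambda>p. \<Sum>j \<in> indices (take n (dims B)).
               entry A (take r p @ j) * entry B (j @ drop r p)))"

text \<open>The transpose depends on the grouping of the modes: the first \<open>m\<close> modes of \<open>A\<close> are moved
  behind the remaining \<open>n\<close> ones, so that an index \<open>j @ i\<close> of the transpose stands for \<open>i @ j\<close>.\<close>

definition btranspose :: "nat \<Rightarrow> btensor \<Rightarrow> btensor" where
  "btranspose m A =
     (let n = length (dims A) - m in
      mk_btensor (drop m (dims A) @ take m (dims A)) (\<lambda>p. entry A (drop n p @ take n p)))"

text \<open>Here \<open>n\<close> is the number of contracted (trailing) modes of \<open>A\<close>.\<close>

definition brange :: "nat \<Rightarrow> btensor \<Rightarrow> btensor set" where
  "brange n A = {A *\<^bsub>n\<^esub> X | X. dims X = drop (length (dims A) - n) (dims A)}"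

text \<open>The next two are meant for \<open>A\<close> with \<open>dims A = Is @ Js\<close>.\<close>

definition generalized_inverse :: "nat list \<Rightarrow> nat list \<Rightarrow> btensor \<Rightarrow> btensor \<Rightarrow> bool" where
  "generalized_inverse Is Js A X \<longleftrightarrow>
     dims X = Js @ Is \<and> A *\<^bsub>length Js\<^esub> X *\<^bsub>length Is\<^esub> A = A"

definition inverse_1_3 :: "nat list \<Rightarrow> nat list \<Rightarrow> btensor \<Rightarrow> btensor \<Rightarrow> bool" where
  "inverse_1_3 Is Js A X \<longleftrightarrow>
     generalized_inverse Is Js A X \<and>
     btranspose (length Is) (A *\<^bsub>length Js\<^esub> X) = A *\<^bsub>length Js\<^esub> X"

lemma indices_eq: "indices ds = {p. list_all2 (\<lambda>i d. 1 \<le> i \<and> i \<le> d) p ds}"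
  by (induction ds) (auto simp: indices_def set_Cons_def list_all2_Cons2)

lemma length_indices: "p \<in> indices ds \<Longrightarrow> length p = length ds"
  by (auto simp: indices_eq dest: list_all2_lengthD)

lemma append_in_indices:
  "length p = length ds \<Longrightarrow> p @ q \<in> indices (ds @ es) \<longleftrightarrow> p \<in> indices ds \<and> q \<in> indices es"
  by (simp add: indices_eq list_all2_append)

lemma finite_indices: "finite (indices ds)"
proof (induction ds)
  case (Cons d ds)
  have "indices (d # ds) = (\<lambda>(x, xs). x # xs) ` ({1..d} \<times> indices ds)"
    by (auto simp: indices_def set_Cons_def)
  then show ?case using Cons by simp
qed (simp add: indices_def)

lemma Rep_mk_btensor:
  "Rep_btensor (mk_btensor ds f) = (ds, \<lambda>p. if p \<in> indices ds then f p else undefined)"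
  unfolding mk_btensor_def by (rule Abs_btensor_inverse) auto

lemma dims_mk_btensor [simp]: "dims (mk_btensor ds f) = ds"
  by (simp add: dims_def Rep_mk_btensor)

lemma entry_mk_btensor [simp]: "p \<in> indices ds \<Longrightarrow> entry (mk_btensor ds f) p = f p"
  by (simp add: entry_def Rep_mk_btensor)

lemma btensor_eqI:
  assumes "dims A = dims B" and "\<And>p. p \<in> indices (dims A) \<Longrightarrow> entry A p = entry B p"
  shows "A = B"
proof -
  have undef: "entry C p = undefined" if "p \<notin> indices (dims C)" for C p
    using Rep_btensor[of C] that by (auto simp: dims_def entry_def)
  have "entry A = entry B"
  proof
    show "entry A p = entry B p" for p
      using assms undef[of p A] undef[of p B] by (cases "p \<in> indices (dims A)") auto
  qed
  then show ?thesis
    using assms(1) by (simp add: dims_def entry_def prod_eq_iff flip: Rep_btensor_inject)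
qed

lemma dims_einstein_prod:
  assumes "dims A = Is @ Js" and "dims B = Js @ Ks"
  shows "dims (A *\<^bsub>length Js\<^esub> B) = Is @ Ks"
  using assms by (simp add: einstein_prod_def Let_def)

lemma entry_einstein_prod:
  assumes "dims A = Is @ Js" and "dims B = Js @ Ks" and "i \<in> indices Is" and "k \<in> indices Ks"
  shows "entry (A *\<^bsub>length Js\<^esub> B) (i @ k) = (\<Sum>j \<in> indices Js. entry A (i @ j) * entry B (j @ k))"
  using assms by (simp add: einstein_prod_def Let_def append_in_indices length_indices)

lemma dims_btranspose:
  assumes "dims A = Is @ Js"
  shows "dims (btranspose (length Is) A) = Js @ Is"
  using assms by (simp add: btranspose_def Let_def)

lemma entry_btranspose:
  assumes "dims A = Is @ Js" and "i \<in> indices Is" and "j \<in> indices Js"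
  shows "entry (btranspose (length Is) A) (j @ i) = entry A (i @ j)"
  using assms by (simp add: btranspose_def Let_def append_in_indices length_indices)

lemma brange_eq:
  assumes "dims A = Is @ Js"
  shows "brange (length Js) A = {A *\<^bsub>length Js\<^esub> X | X. dims X = Js}"
  using assms by (simp add: brange_def)

end

theory Submission
  imports Defs
begin

text \<open>With the modes grouped into row indices \<open>Is\<close> and column indices \<open>Js\<close>, a Boolean tensor is a
  matrix over the Boolean algebra, or equivalently a relation between \<open>indices Is\<close> and
  \<open>indices Js\<close>. Its product is relational composition and its transpose is the converse. So the
  Einstein product is associative and transposition is an involution that reverses products. The
  theorem then follows from two facts.

  First, \<open>X\<close> is a \<open>{1,3}\<close>-inverse of \<open>A\<close> iff \<open>A\<^sup>T = A\<^sup>T A X\<close> (\<open>inverse_1_3_iff\<close>), so that (a) and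
  (c) have the same witnesses. If \<open>A X A = A\<close> with \<open>A X\<close> symmetric, then
  \<open>A\<^sup>T = (A X A)\<^sup>T = A\<^sup>T (A X)\<^sup>T = A\<^sup>T A X\<close>. Conversely, transposing \<open>A\<^sup>T = A\<^sup>T A X\<close> gives
  \<open>A = (A X)\<^sup>T A\<close>. Hence \<open>A X = (A X)\<^sup>T (A X)\<close> is symmetric, and \<open>A X A = (A X)\<^sup>T A = A\<close>.

  Second, \<open>\<RR>(B) \<subseteq> \<RR>(C)\<close> holds iff \<open>B\<close> factors as \<open>C X\<close> (\<open>brange_subset_iff\<close>): the columns of \<open>B\<close>
  lie in its range, and if each is \<open>C\<close> applied to some vector, these vectors are the columns of
  \<open>X\<close>. Since \<open>\<RR>(A\<^sup>T A) \<subseteq> \<RR>(A\<^sup>T)\<close> always holds, the range condition in (b) says exactly that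
  \<open>A\<^sup>T\<close> factors through \<open>A\<^sup>T A\<close>, which is (c).\<close>

lemma sum_bool_iff: "finite S \<Longrightarrow> (\<Sum>j\<in>S. f j :: bool) \<longleftrightarrow> (\<exists>j\<in>S. f j)"
  by (induction S rule: finite_induct) (auto simp: plus_bool_def zero_bool_def)

lemma Nil_in_indices [simp]: "[] \<in> indices []"
  by (simp add: indices_eq)

lemma in_indices_appendE:
  assumes "p \<in> indices (Is @ Js)"
  obtains i j where "p = i @ j" "i \<in> indices Is" "j \<in> indices Js"
  using assms by (auto simp: indices_eq list_all2_append2)

lemma btensor_eqI_append:
  assumes "dims A = Is @ Js" and "dims B = Is @ Js"
    and "\<And>i j. i \<in> indices Is \<Longrightarrow> j \<in> indices Js \<Longrightarrow> entry A (i @ j) = entry B (i @ j)"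
  shows "A = B"
  by (rule btensor_eqI) (auto simp: assms elim!: in_indices_appendE)

lemma entry_einstein_prod_iff:
  assumes "dims A = Is @ Js" and "dims B = Js @ Ks" and "i \<in> indices Is" and "k \<in> indices Ks"
  shows "entry (A *\<^bsub>length Js\<^esub> B) (i @ k) \<longleftrightarrow>
    (\<exists>j\<in>indices Js. entry A (i @ j) \<and> entry B (j @ k))"
  by (simp add: entry_einstein_prod[OF assms] sum_bool_iff finite_indices times_bool_def)

lemma einstein_prod_assoc:
  assumes A: "dims A = Is @ Js" and B: "dims B = Js @ Ks" and C: "dims C = Ks @ Ls"
  shows "A *\<^bsub>length Js\<^esub> B *\<^bsub>length Ks\<^esub> C = A *\<^bsub>length Js\<^esub> (B *\<^bsub>length Ks\<^esub> C)"
proof (rule btensor_eqI_append)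
  note AB = dims_einstein_prod[OF A B] and BC = dims_einstein_prod[OF B C]
  show "dims (A *\<^bsub>length Js\<^esub> B *\<^bsub>length Ks\<^esub> C) = Is @ Ls" by (rule dims_einstein_prod[OF AB C])
  show "dims (A *\<^bsub>length Js\<^esub> (B *\<^bsub>length Ks\<^esub> C)) = Is @ Ls" by (rule dims_einstein_prod[OF A BC])
  fix i l assume i: "i \<in> indices Is" and l: "l \<in> indices Ls"
  show "entry (A *\<^bsub>length Js\<^esub> B *\<^bsub>length Ks\<^esub> C) (i @ l) =
    entry (A *\<^bsub>length Js\<^esub> (B *\<^bsub>length Ks\<^esub> C)) (i @ l)"
    using i l entry_einstein_prod_iff[OF A B] entry_einstein_prod_iff[OF B C]
    by (auto simp: entry_einstein_prod_iff[OF AB C] entry_einstein_prod_iff[OF A BC])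
qed

lemma btranspose_btranspose:
  assumes A: "dims A = Is @ Js"
  shows "btranspose (length Js) (btranspose (length Is) A) = A"
proof (rule btensor_eqI_append[OF _ A])
  note T = dims_btranspose[OF A]
  show "dims (btranspose (length Js) (btranspose (length Is) A)) = Is @ Js"
    by (rule dims_btranspose[OF T])
  fix i j assume "i \<in> indices Is" and "j \<in> indices Js"
  then show "entry (btranspose (length Js) (btranspose (length Is) A)) (i @ j) = entry A (i @ j)"
    by (simp add: entry_btranspose[OF T] entry_btranspose[OF A])
qed

lemma btranspose_einstein_prod:
  assumes A: "dims A = Is @ Js" and B: "dims B = Js @ Ks"
  shows "btranspose (length Is) (A *\<^bsub>length Js\<^esub> B) =
    btranspose (length Js) B *\<^bsub>length Js\<^esub> btranspose (length Is) A"
proof (rule btensor_eqI_append)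
  note AB = dims_einstein_prod[OF A B] and AT = dims_btranspose[OF A]
    and BT = dims_btranspose[OF B]
  show "dims (btranspose (length Is) (A *\<^bsub>length Js\<^esub> B)) = Ks @ Is" by (rule dims_btranspose[OF AB])
  show "dims (btranspose (length Js) B *\<^bsub>length Js\<^esub> btranspose (length Is) A) = Ks @ Is"
    by (rule dims_einstein_prod[OF BT AT])
  fix k i assume k: "k \<in> indices Ks" and i: "i \<in> indices Is"
  show "entry (btranspose (length Is) (A *\<^bsub>length Js\<^esub> B)) (k @ i) =
    entry (btranspose (length Js) B *\<^bsub>length Js\<^esub> btranspose (length Is) A) (k @ i)"
    using i k entry_btranspose[OF A] entry_btranspose[OF B]
    by (auto simp: entry_btranspose[OF AB] entry_einstein_prod_iff[OF A B]
        entry_einstein_prod_iff[OF BT AT])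
qed

text \<open>A vector has no column modes, so its entries are the case \<open>Ks = []\<close> of
  \<open>entry_einstein_prod_iff\<close>, with the empty column index removed.\<close>

lemma entry_einstein_prod_vector_iff:
  assumes "dims A = Is @ Js" and "dims x = Js" and "i \<in> indices Is"
  shows "entry (A *\<^bsub>length Js\<^esub> x) i \<longleftrightarrow> (\<exists>j\<in>indices Js. entry A (i @ j) \<and> entry x j)"
  using entry_einstein_prod_iff[of A Is Js x "[]" i "[]"] assms by simp

text \<open>Forward, \<open>B\<close> applied to the unit vector at \<open>j\<close> is the \<open>j\<close>-th column of \<open>B\<close>, so each column is
  \<open>C\<close> applied to some \<open>x j\<close>; the tensor with columns \<open>x j\<close> is the factor. Backward,
  \<open>(C X) y = C (X y)\<close>.\<close>

lemma brange_subset_iff: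
  assumes B: "dims B = Is @ Js" and C: "dims C = Is @ Ks"
  shows "brange (length Js) B \<subseteq> brange (length Ks) C \<longleftrightarrow>
    (\<exists>X. dims X = Ks @ Js \<and> B = C *\<^bsub>length Ks\<^esub> X)"
proof
  assume sub: "brange (length Js) B \<subseteq> brange (length Ks) C"
  let ?unit = "\<lambda>j. mk_btensor Js (\<lambda>p. p = j)"
  have "\<exists>x. dims x = Ks \<and> B *\<^bsub>length Js\<^esub> ?unit j = C *\<^bsub>length Ks\<^esub> x" for j
  proof -
    have "B *\<^bsub>length Js\<^esub> ?unit j \<in> brange (length Js) B"
      by (auto simp: brange_eq[OF B])
    with sub show ?thesis by (auto simp: brange_eq[OF C])
  qed
  then obtain x where dims_x: "\<And>j. dims (x j) = Ks"
    and x: "\<And>j. B *\<^bsub>length Js\<^esub> ?unit j = C *\<^bsub>length Ks\<^esub> x j"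
    by metis
  define X where "X = mk_btensor (Ks @ Js) (\<lambda>p. entry (x (drop (length Ks) p)) (take (length Ks) p))"
  have dims_X: "dims X = Ks @ Js" by (simp add: X_def)
  have entry_X: "entry X (k @ j) = entry (x j) k" if "k \<in> indices Ks" "j \<in> indices Js" for k j
    using that by (simp add: X_def append_in_indices length_indices)
  have "B = C *\<^bsub>length Ks\<^esub> X"
  proof (rule btensor_eqI_append[OF B dims_einstein_prod[OF C dims_X]])
    fix i j assume i: "i \<in> indices Is" and j: "j \<in> indices Js"
    have "entry B (i @ j) \<longleftrightarrow> entry (B *\<^bsub>length Js\<^esub> ?unit j) i"
      using i j by (auto simp: entry_einstein_prod_vector_iff[OF B])
    also have "\<dots> \<longleftrightarrow> (\<exists>k\<in>indices Ks. entry C (i @ k) \<and> entry (x j) k)"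
      unfolding x by (rule entry_einstein_prod_vector_iff[OF C dims_x i])
    also have "\<dots> \<longleftrightarrow> entry (C *\<^bsub>length Ks\<^esub> X) (i @ j)"
      using i j entry_X by (auto simp: entry_einstein_prod_iff[OF C dims_X])
    finally show "entry B (i @ j) = entry (C *\<^bsub>length Ks\<^esub> X) (i @ j)" .
  qed
  with dims_X show "\<exists>X. dims X = Ks @ Js \<and> B = C *\<^bsub>length Ks\<^esub> X" by blast
next
  assume "\<exists>X. dims X = Ks @ Js \<and> B = C *\<^bsub>length Ks\<^esub> X"
  then obtain X where X: "dims X = Ks @ Js" and eq: "B = C *\<^bsub>length Ks\<^esub> X" by blast
  have "B *\<^bsub>length Js\<^esub> y \<in> brange (length Ks) C" if y: "dims y = Js" for y
  proof -
    have y': "dims y = Js @ []" using y by simp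
    have "B *\<^bsub>length Js\<^esub> y = C *\<^bsub>length Ks\<^esub> (X *\<^bsub>length Js\<^esub> y)"
      unfolding eq by (rule einstein_prod_assoc[OF C X y'])
    moreover have "dims (X *\<^bsub>length Js\<^esub> y) = Ks"
      using dims_einstein_prod[OF X y'] by simp
    ultimately show ?thesis by (auto simp: brange_eq[OF C])
  qed
  then show "brange (length Js) B \<subseteq> brange (length Ks) C"
    by (auto simp: brange_eq[OF B])
qed

text \<open>The equation \<open>A\<^sup>T = A\<^sup>T A X\<close> is the transpose of \<open>(A X)\<^sup>T A = A\<close>. Multiplying the
  latter by \<open>X\<close> on the right gives \<open>A X = (A X)\<^sup>T (A X)\<close>, which is why \<open>A X\<close> is symmetric. Below,
  \<open>P\<close> is the would-be projection \<open>A X\<close>.\<close>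

lemma inverse_1_3_iff:
  assumes A: "dims A = Is @ Js"
  shows "inverse_1_3 Is Js A X \<longleftrightarrow> dims X = Js @ Is \<and>
    btranspose (length Is) A = btranspose (length Is) A *\<^bsub>length Is\<^esub> A *\<^bsub>length Js\<^esub> X"
proof (cases "dims X = Js @ Is")
  case X: True
  define P where "P = A *\<^bsub>length Js\<^esub> X"
  let ?AT = "btranspose (length Is) A" and ?PT = "btranspose (length Is) P"
  have P: "dims P = Is @ Is" unfolding P_def by (rule dims_einstein_prod[OF A X])
  note AT = dims_btranspose[OF A] and PT = dims_btranspose[OF P]
  have assoc: "?AT *\<^bsub>length Is\<^esub> A *\<^bsub>length Js\<^esub> X = ?AT *\<^bsub>length Is\<^esub> P"
    unfolding P_def by (rule einstein_prod_assoc[OF AT A X])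
  have "inverse_1_3 Is Js A X \<longleftrightarrow> P *\<^bsub>length Is\<^esub> A = A \<and> ?PT = P"
    by (simp add: inverse_1_3_def generalized_inverse_def X P_def)
  also have "\<dots> \<longleftrightarrow> ?AT = ?AT *\<^bsub>length Is\<^esub> P"
  proof
    assume *: "P *\<^bsub>length Is\<^esub> A = A \<and> ?PT = P"
    have "?AT = btranspose (length Is) (P *\<^bsub>length Is\<^esub> A)" using * by simp
    also have "\<dots> = ?AT *\<^bsub>length Is\<^esub> ?PT" by (rule btranspose_einstein_prod[OF P A])
    finally show "?AT = ?AT *\<^bsub>length Is\<^esub> P" using * by simp
  next
    assume *: "?AT = ?AT *\<^bsub>length Is\<^esub> P"
    have "A = btranspose (length Js) (?AT *\<^bsub>length Is\<^esub> P)"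
      using * btranspose_btranspose[OF A] by simp
    also have "\<dots> = ?PT *\<^bsub>length Is\<^esub> btranspose (length Js) ?AT"
      by (rule btranspose_einstein_prod[OF AT P])
    finally have PTA: "?PT *\<^bsub>length Is\<^esub> A = A" by (simp add: btranspose_btranspose[OF A])
    have PTP: "?PT *\<^bsub>length Is\<^esub> P = P"
      using einstein_prod_assoc[OF PT A X] by (simp add: PTA flip: P_def)
    have "?PT = btranspose (length Is) (?PT *\<^bsub>length Is\<^esub> P)" by (simp add: PTP)
    also have "\<dots> = ?PT *\<^bsub>length Is\<^esub> P"
      by (simp add: btranspose_einstein_prod[OF PT P] btranspose_btranspose[OF P])
    finally have sym: "?PT = P" by (simp add: PTP)
    with PTA show "P *\<^bsub>length Is\<^esub> A = A \<and> ?PT = P" by simp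
  qed
  finally show ?thesis by (simp add: X assoc)
qed (simp add: inverse_1_3_def generalized_inverse_def)

theorem theorem3p24:
  fixes A :: btensor and Is Js :: "nat list" and M N :: nat
  assumes "length Is = M" and "length Js = N" and "dims A = Is @ Js"
  shows "((\<exists>X. inverse_1_3 Is Js A X) \<longleftrightarrow>
          (\<exists>X. generalized_inverse Is Js A X) \<and>
          brange M (btranspose M A) = brange N (btranspose M A *\<^bsub>M\<^esub> A))
       \<and> ((\<exists>X. inverse_1_3 Is Js A X) \<longleftrightarrow>
          (\<exists>X. dims X = Js @ Is \<and>
               btranspose M A = btranspose M A *\<^bsub>M\<^esub> A *\<^bsub>N\<^esub> X))"
proof -
  let ?AT = "btranspose M A"
  have AT: "dims ?AT = Js @ Is" using dims_btranspose[OF assms(3)] assms(1) by simp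
  have ATA: "dims (?AT *\<^bsub>M\<^esub> A) = Js @ Js"
    using dims_einstein_prod[OF AT assms(3)] assms(1) by simp
  have a_iff_c: "(\<exists>X. inverse_1_3 Is Js A X) \<longleftrightarrow>
      (\<exists>X. dims X = Js @ Is \<and> ?AT = ?AT *\<^bsub>M\<^esub> A *\<^bsub>N\<^esub> X)"
    using inverse_1_3_iff[OF assms(3)] assms(1,2) by simp
  have "brange N (?AT *\<^bsub>M\<^esub> A) \<subseteq> brange M ?AT"
    using brange_subset_iff[OF ATA AT] assms by auto
  moreover have "brange M ?AT \<subseteq> brange N (?AT *\<^bsub>M\<^esub> A) \<longleftrightarrow>
      (\<exists>X. dims X = Js @ Is \<and> ?AT = ?AT *\<^bsub>M\<^esub> A *\<^bsub>N\<^esub> X)"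
    using brange_subset_iff[OF AT ATA] assms(1,2) by simp
  ultimately have range_iff_c: "brange M ?AT = brange N (?AT *\<^bsub>M\<^esub> A) \<longleftrightarrow>
      (\<exists>X. dims X = Js @ Is \<and> ?AT = ?AT *\<^bsub>M\<^esub> A *\<^bsub>N\<^esub> X)"
    by blast
  have "\<exists>X. generalized_inverse Is Js A X" if "\<exists>X. inverse_1_3 Is Js A X"
    using that by (auto simp: inverse_1_3_def)
  with a_iff_c range_iff_c show ?thesis by blast
qed

end
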